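(* Let $p = 1/2$ and let $F = C_5$ be the cycle on five vertices. For every kernel $\Delta$ with $\int_0^1\int_0^1 \Delta(x,y)\,dx\,dy = 0$ and $\Delta \not\equiv 0$ (i.e. $\Delta$ is not almost everywhere zero), there are constants $c = c(\Delta) > 0$ and $\varepsilon_0 = \varepsilon_0(\Delta) > 0$ such that for all real $\varepsilon$ with $|\varepsilon| \leq \varepsilon_0$, $$\rho_F(W_p + \varepsilon \Delta) \leq \operatorname{rand}(F,p) - c\, \varepsilon^4 .$$
   Context: A kernel is a bounded symmetric measurable function $W:[0,1]^2 \to \mathbb{R}$. For $p\in[0,1]$, $W_p$ denotes the constant function $W_p \equiv p$ on $[0,1]^2$. For a finite simple labeled graph $F$ with vertex set identified with $[m]=\{1,\dots,m\}$, edge set $E$, and set of non-edges $\overline{E} = \binom{[m]}{2}\setminus E$, and a kernel $W$, $$\rho_F(W) = \int_{[0,1]^m} \prod_{e \in E} W(x_{e_1},x_{e_2}) \prod_{f \in \overline{E}}(1 - W(x_{f_1},x_{f_2})) \,dx_1\cdots dx_m,$$ where $e_1,e_2$ denote the two endpoints of $e$. Also $\operatorname{rand}(F,p) = p^{|E|}(1-p)^{\binom{m}{2}-|E|}$. *)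

theory Defs
  imports "HOL-Analysis.Analysis"
begin

abbreviation unit_square :: "(real \<times> real) set" where
  "unit_square \<equiv> {0..1} \<times> {0..1}"

text \<open>Measurability is Lebesgue measurability. Values of \<open>W\<close> outside the unit square are irrelevant
  everywhere below.\<close>

definition is_kernel :: "(real \<times> real \<Rightarrow> real) \<Rightarrow> bool" where
  "is_kernel W \<longleftrightarrow>
     W \<in> borel_measurable (lebesgue_on unit_square) \<and>
     bounded (W ` unit_square) \<and>
     (\<forall>x\<in>{0..1}. \<forall>y\<in>{0..1}. W (x, y) = W (y, x))"

definition const_kernel :: "real \<Rightarrow> real \<times> real \<Rightarrow> real" where
  "const_kernel p = (\<lambda>_. p)"

text \<open>A labeled graph on the vertex set \<open>{1..m}\<close> is given by \<open>m\<close> and its set of edges, each edge being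
  the set of its two endpoints.\<close>

definition vertex_pairs :: "nat \<Rightarrow> nat set set" where
  "vertex_pairs m = {e. e \<subseteq> {1..m} \<and> card e = 2}"

definition simple_graph :: "nat \<Rightarrow> nat set set \<Rightarrow> bool" where
  "simple_graph m E \<longleftrightarrow> E \<subseteq> vertex_pairs m"

definition non_edges :: "nat \<Rightarrow> nat set set \<Rightarrow> nat set set" where
  "non_edges m E = vertex_pairs m - E"

text \<open>Lebesgue measure on \<open>[0,1]\<^sup>m\<close>, points being functions on \<open>{1..m}\<close>. The product of the
  one-dimensional measures is completed: for a kernel \<open>W\<close> that is Lebesgue but not Borel measurable,
  \<open>x \<mapsto> W (x i, x j)\<close> need not be measurable for the uncompleted product.\<close>

definition cube_measure :: "nat \<Rightarrow> (nat \<Rightarrow> real) measure" where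
  "cube_measure m = completion (Pi\<^sub>M {1..m} (\<lambda>_. restrict_space lborel {0..1}))"

text \<open>The endpoints of an edge \<open>e\<close> are \<open>Min e\<close> and \<open>Max e\<close>; their order does not matter, kernels being
  symmetric.\<close>

definition rho :: "nat \<Rightarrow> nat set set \<Rightarrow> (real \<times> real \<Rightarrow> real) \<Rightarrow> real" where
  "rho m E W =
     (\<integral>x. (\<Prod>e\<in>E. W (x (Min e), x (Max e))) *
          (\<Prod>f\<in>non_edges m E. 1 - W (x (Min f), x (Max f))) \<partial>cube_measure m)"

definition rand :: "nat \<Rightarrow> nat set set \<Rightarrow> real \<Rightarrow> real" where
  "rand m E p = p ^ card E * (1 - p) ^ ((m choose 2) - card E)"

definition C5_edges :: "nat set set" where
  "C5_edges = {{1,2}, {2,3}, {3,4}, {4,5}, {5,1}}"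

lemma simple_graph_C5: "simple_graph 5 C5_edges"
  by (auto simp: simple_graph_def C5_edges_def vertex_pairs_def)

end

theory Submission
  imports Defs "HOL-Probability.Infinite_Product_Measure"
begin

text \<open>
  Read the integrals as expectations over five independent uniform points. For \<open>p = 1/2\<close> each factor of
  the integrand is \<open>(1 \<plusminus> 2 \<epsilon> \<Delta>) / 2\<close>, with sign \<open>\<sigma> = +1\<close> on the edges of \<open>C\<^sub>5\<close> and \<open>\<sigma> = -1\<close> on the
  non-edges. So the density is \<open>1/1024\<close> times the expectation of the product of \<open>1 + a \<sigma>(e) \<Delta>\<^sub>e\<close> over the
  ten edges \<open>e\<close> of \<open>K\<^sub>5\<close>, where \<open>a = 2 \<epsilon>\<close> (\<open>rho_C5_eq\<close>). Expanded in powers of \<open>a\<close>, it is a polynomial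
  whose \<open>k\<close>-th coefficient \<open>c\<^sub>k\<close> is the sum of \<open>\<sigma>(S) t(S)\<close> over the \<open>k\<close>-edge subgraphs \<open>S\<close> of \<open>K\<^sub>5\<close>, with
  \<open>t(S)\<close> the homomorphism density of \<open>S\<close> in \<open>\<Delta>\<close> (\<open>signed_expectation_expand\<close>). Three facts decide the sign.

  First, \<open>C\<^sub>5\<close> is self-complementary: relabelling the points by \<open>i \<mapsto> 2 i mod 5\<close> turns \<open>\<sigma>\<close> into \<open>-\<sigma>\<close>, so the
  polynomial is even (\<open>signed_expectation_even\<close>).

  Second, two disjoint edges contribute nothing to \<open>c\<^sub>2\<close> as \<open>\<Delta>\<close> has mean zero, a path with two edges
  contributes the integral of the squared degree function \<open>d(y) = \<integral> \<Delta>(x, y) dx\<close>, and the signs of these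
  paths sum to \<open>-10\<close>. Hence \<open>c\<^sub>2 = -10 \<integral> d\<^sup>2 \<le> 0\<close> (\<open>coefficient_2\<close>).

  Third, if \<open>c\<^sub>2 = 0\<close>, then \<open>d\<close> vanishes almost everywhere, and integrating over a vertex of degree one shows
  that every graph with a leaf has density zero. The only 4-edge subgraphs of \<open>K\<^sub>5\<close> without a leaf are
  4-cycles, whose signs sum to \<open>-5\<close>; so \<open>c\<^sub>4 = -5 t(C\<^sub>4)\<close> (\<open>coefficient_4\<close>). The density \<open>t(C\<^sub>4)\<close> is the
  integral of the squared codegree function, and it is zero only if \<open>\<Delta>\<close> is zero almost everywhere
  (\<open>C4_density_eq_0_imp_AE_0\<close>).

  So the lowest nonzero coefficient after the constant is negative and of order 2 or 4, which gives the
  bound for small \<open>\<epsilon>\<close> (\<open>even_polynomial_bound\<close>). The argument runs for Borel kernels on a probability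
  space; a Lebesgue measurable \<open>\<Delta>\<close> is first replaced by an almost everywhere equal Borel version, which
  changes the integrand only on a null set (\<open>borel_version_of_kernel\<close>).
\<close>

section \<open>Kernels evaluated at independent random points\<close>

text \<open>
  The measure \<open>P\<close> below is the law of independent \<open>M\<close>-distributed points indexed by \<open>I\<close>. Symmetry and the
  bound are required for all arguments, also outside \<open>space M\<close>, which keeps estimates free of side conditions.
\<close>

locale bounded_symmetric_kernel = prob_space M for M :: "'a measure" +
  fixes K :: "'a \<Rightarrow> 'a \<Rightarrow> real" and B :: real and I :: "'i set"
  assumes finite_I [simp]: "finite I"
    and K_measurable: "case_prod K \<in> borel_measurable (M \<Otimes>\<^sub>M M)"
    and K_sym: "K x y = K y x"
    and K_bound: "\<bar>K x y\<bar> \<le> B"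
begin

abbreviation P :: "('i \<Rightarrow> 'a) measure" where
  "P \<equiv> Pi\<^sub>M I (\<lambda>_. M)"

sublocale P: prob_space P
  by (rule prob_space_PiM) (rule prob_space_axioms)

sublocale MM: pair_prob_space M M ..

lemma B_nonneg: "0 \<le> B"
  using K_bound[of undefined undefined] by linarith

lemma measurable_kernel [measurable (raw)]:
  assumes "f \<in> measurable N M" "g \<in> measurable N M"
  shows "(\<lambda>w. K (f w) (g w)) \<in> borel_measurable N"
  using measurable_compose[OF measurable_Pair[OF assms] K_measurable] by simp

lemma abs_expectation_le:
  fixes f :: "'a \<Rightarrow> real"
  assumes "\<And>x. \<bar>f x\<bar> \<le> C"
  shows "\<bar>\<integral>x. f x \<partial>M\<bar> \<le> C"
proof (cases "integrable M f")
  case True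
  then have "\<bar>\<integral>x. f x \<partial>M\<bar> \<le> (\<integral>x. \<bar>f x\<bar> \<partial>M)" by (intro integral_abs_bound)
  also have "\<dots> \<le> (\<integral>x. C \<partial>M)"
    using True assms by (intro integral_mono) auto
  finally show ?thesis by (simp add: prob_space)
next
  case False
  then show ?thesis
    using assms[of undefined] by (simp add: not_integrable_integral_eq)
qed

text \<open>
  Fubini in the form of resampling one coordinate. Since the outer integral is again over \<open>P\<close>, the rule can be
  applied to one coordinate after another without passing to smaller products.
\<close>

lemma integrate_out:
  assumes f [measurable]: "f \<in> borel_measurable P" and bound: "\<And>x. \<bar>f x\<bar> \<le> (C::real)"
    and i: "i \<in> I"
  shows "(\<integral>x. f x \<partial>P) = (\<integral>x. (\<integral>y. f (x(i := y)) \<partial>M) \<partial>P)"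
proof -
  interpret prod: product_sigma_finite "\<lambda>_. M" ..
  let ?J = "I - {i}"
  have I_eq: "insert i ?J = I" using i by auto
  let ?g = "\<lambda>x. \<integral>y. f (x(i := y)) \<partial>M"
  have fin: "finite ?J" "i \<notin> ?J" by auto
  have upd [measurable]: "(\<lambda>z. (fst z)(i := snd z)) \<in> measurable (P \<Otimes>\<^sub>M M) P"
    by (rule measurable_fun_upd[where J="I"]) (use i in auto)
  have [measurable]: "?g \<in> borel_measurable P"
  proof -
    have "(\<lambda>(x, y). f (x(i := y))) \<in> borel_measurable (P \<Otimes>\<^sub>M M)"
      using measurable_compose[OF upd f] by (simp add: case_prod_beta')
    then show ?thesis by (rule borel_measurable_lebesgue_integral)
  qed
  have gb: "\<bar>?g x\<bar> \<le> C" for x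
    by (rule abs_expectation_le[OF bound])
  have intf: "integrable P f" using bound by (intro P.integrable_const_bound[of _ C]) auto
  have intg: "integrable P ?g" using gb by (intro P.integrable_const_bound[of _ C]) auto
  have "(\<integral>x. ?g x \<partial>P) = (\<integral>x. (\<integral>y. ?g (x(i := y)) \<partial>M) \<partial>Pi\<^sub>M ?J (\<lambda>_. M))"
    using prod.product_integral_insert[OF fin, of ?g] intg unfolding I_eq by simp
  also have "\<dots> = (\<integral>x. ?g x \<partial>Pi\<^sub>M ?J (\<lambda>_. M))"
    by (simp add: prob_space)
  also have "\<dots> = (\<integral>x. f x \<partial>P)"
    using prod.product_integral_insert[OF fin, of f] intf unfolding I_eq by simp
  finally show ?thesis by simp
qed

lemma distr_pair_coordinates:
  assumes "i \<in> I" "j \<in> I" "i \<noteq> j"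
  shows "distr P (M \<Otimes>\<^sub>M M) (\<lambda>x. (x i, x j)) = M \<Otimes>\<^sub>M M"
proof (rule pair_measure_eqI[symmetric])
  interpret prod: product_prob_space "\<lambda>_. M" "I" ..
  interpret prod: finite_product_prob_space "\<lambda>_. M" "I" by standard (rule finite_I)
  fix A B assume [measurable]: "A \<in> sets M" "B \<in> sets M"
  let ?F = "\<lambda>k. if k = i then A else if k = j then B else space M"
  have "(\<lambda>x. (x i, x j)) -` (A \<times> B) \<inter> space P = Pi\<^sub>E I ?F" (is "?L = ?R")
  proof
    show "?L \<subseteq> ?R" by (auto simp: space_PiM PiE_iff)
    show "?R \<subseteq> ?L"
    proof
      fix x assume x: "x \<in> ?R"
      have "?F k \<subseteq> space M" for k by (auto dest: sets.sets_into_space[OF \<open>A \<in> sets M\<close>, THEN subsetD]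
          sets.sets_into_space[OF \<open>B \<in> sets M\<close>, THEN subsetD] split: if_splits)
      then have "x \<in> space P" using x unfolding space_PiM PiE_iff by blast
      moreover have "x i \<in> A" "x j \<in> B" using PiE_mem[OF x assms(1)] PiE_mem[OF x assms(2)] assms(3) by auto
      ultimately show "x \<in> ?L" by auto
    qed
  qed
  then have "emeasure (distr P (M \<Otimes>\<^sub>M M) (\<lambda>x. (x i, x j))) (A \<times> B) = emeasure P (Pi\<^sub>E I ?F)"
    using assms by (subst emeasure_distr) auto
  also have "\<dots> = (\<Prod>k\<in>I. emeasure M (?F k))"
    by (subst prod.emeasure_PiM) auto
  also have "\<dots> = (\<Prod>k\<in>{i, j}. emeasure M (?F k))"
    using assms by (intro prod.mono_neutral_right) (auto simp: emeasure_space_1)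
  also have "\<dots> = emeasure M A * emeasure M B"
    using assms by auto
  finally show "emeasure M A * emeasure M B = emeasure (distr P (M \<Otimes>\<^sub>M M) (\<lambda>x. (x i, x j))) (A \<times> B)"
    by simp
qed (auto intro: sigma_finite_measure_axioms)

lemma expectation_pair_coordinates:
  fixes f :: "'a \<times> 'a \<Rightarrow> real"
  assumes "i \<in> I" "j \<in> I" "i \<noteq> j" "f \<in> borel_measurable (M \<Otimes>\<^sub>M M)"
  shows "(\<integral>x. f (x i, x j) \<partial>P) = (\<integral>z. f z \<partial>(M \<Otimes>\<^sub>M M))"
proof -
  have "(\<integral>z. f z \<partial>(M \<Otimes>\<^sub>M M)) = (\<integral>z. f z \<partial>distr P (M \<Otimes>\<^sub>M M) (\<lambda>x. (x i, x j)))"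
    using distr_pair_coordinates assms(1-3) by simp
  also have "\<dots> = (\<integral>x. f (x i, x j) \<partial>P)"
    using assms by (intro integral_distr) auto
  finally show ?thesis by simp
qed

lemma AE_pair_coordinates:
  assumes "i \<in> I" "j \<in> I" "i \<noteq> j" "AE z in M \<Otimes>\<^sub>M M. Q z"
  shows "AE x in P. Q (x i, x j)"
proof (rule AE_distrD[where M' = "M \<Otimes>\<^sub>M M"])
  show "(\<lambda>x. (x i, x j)) \<in> measurable P (M \<Otimes>\<^sub>M M)" using assms by auto
  show "AE z in distr P (M \<Otimes>\<^sub>M M) (\<lambda>x. (x i, x j)). Q z"
    using assms(4) by (simp only: distr_pair_coordinates[OF assms(1-3)])
qed

definition kernel_degree :: "'a \<Rightarrow> real" where
  "kernel_degree y = (\<integral>x. K x y \<partial>M)"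

text \<open>The square of \<open>K\<close> as an integral operator; for a graph it counts common neighbours.\<close>

definition codegree :: "'a \<Rightarrow> 'a \<Rightarrow> real" where
  "codegree x z = (\<integral>y. K x y * K y z \<partial>M)"

lemma measurable_kernel_degree [measurable]: "kernel_degree \<in> borel_measurable M"
  unfolding kernel_degree_def by measurable

lemma measurable_codegree [measurable]: "case_prod codegree \<in> borel_measurable (M \<Otimes>\<^sub>M M)"
  unfolding codegree_def case_prod_beta' by measurable

lemma measurable_codegree_raw [measurable (raw)]:
  assumes "f \<in> measurable N M" "g \<in> measurable N M"
  shows "(\<lambda>w. codegree (f w) (g w)) \<in> borel_measurable N"
  using measurable_compose[OF measurable_Pair[OF assms] measurable_codegree] by simp

lemma abs_K_mult_le: "\<bar>a\<bar> \<le> C \<Longrightarrow> \<bar>K x y * a\<bar> \<le> B * C"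
  by (simp add: abs_mult K_bound mult_mono B_nonneg)

end

section \<open>Homomorphism densities of small graphs\<close>

text \<open>
  A graph is a list of pairs; which endpoint of an edge comes first is immaterial as kernels are symmetric.
\<close>

definition incidence_count :: "('i \<times> 'i) list \<Rightarrow> 'i \<Rightarrow> nat" where
  "incidence_count S v = (\<Sum>(i, j)\<leftarrow>S. of_bool (i = v) + of_bool (j = v))"

lemma incidence_count_simps [simp]:
  "incidence_count [] v = 0"
  "incidence_count (e # S) v = of_bool (fst e = v) + of_bool (snd e = v) + incidence_count S v"
  by (simp_all add: incidence_count_def case_prod_beta')

text \<open>Isolates the pendant edge at a leaf \<open>v\<close>.\<close>

lemma incidence_count_eq_1E:
  assumes "incidence_count S v = 1"
  obtains S1 e S2 where "S = S1 @ e # S2" "fst e = v \<or> snd e = v" "incidence_count (S1 @ S2) v = 0"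
proof -
  have "\<exists>S1 e S2. S = S1 @ e # S2 \<and> (fst e = v \<or> snd e = v) \<and> incidence_count (S1 @ S2) v = 0"
    using assms
  proof (induction S)
    case (Cons f S)
    show ?case
    proof (cases "fst f = v \<or> snd f = v")
      case True
      then have "incidence_count S v = 0" using Cons.prems by auto
      then show ?thesis using True by (intro exI[of _ "[]"] exI[of _ f] exI[of _ S]) simp
    next
      case False
      then obtain S1 e S2 where "S = S1 @ e # S2" "fst e = v \<or> snd e = v" "incidence_count (S1 @ S2) v = 0"
        using Cons by auto
      then show ?thesis using False by (intro exI[of _ "f # S1"] exI[of _ e] exI[of _ S2]) simp
    qed
  qed simp
  then show ?thesis using that by blast
qed

context bounded_symmetric_kernel
begin

definition edge_product :: "('i \<times> 'i) list \<Rightarrow> ('i \<Rightarrow> 'a) \<Rightarrow> real" where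
  "edge_product S x = (\<Prod>(i, j)\<leftarrow>S. K (x i) (x j))"

definition hom_density :: "('i \<times> 'i) list \<Rightarrow> real" where
  "hom_density S = (\<integral>x. edge_product S x \<partial>P)"

lemma edge_product_simps [simp]:
  "edge_product [] = (\<lambda>_. 1)"
  "edge_product (e # S) x = K (x (fst e)) (x (snd e)) * edge_product S x"
  "edge_product (S @ T) x = edge_product S x * edge_product T x"
  by (auto simp: edge_product_def case_prod_beta' fun_eq_iff)

lemma measurable_edge_product [measurable]:
  assumes "set S \<subseteq> I \<times> I"
  shows "edge_product S \<in> borel_measurable P"
  using assms
proof (induction S)
  case (Cons e S)
  then have "fst e \<in> I" "snd e \<in> I" "edge_product S \<in> borel_measurable P" by auto
  moreover have "edge_product (e # S) = (\<lambda>x. K (x (fst e)) (x (snd e)) * edge_product S x)"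
    by (simp add: fun_eq_iff)
  ultimately show ?case by simp
qed simp

lemma abs_edge_product_le: "\<bar>edge_product S x\<bar> \<le> B ^ length S"
  by (induction S) (auto intro: abs_K_mult_le)

lemma edge_product_update:
  assumes "incidence_count S v = 0"
  shows "edge_product S (x(v := y)) = edge_product S x"
  using assms by (induction S) auto

lemma abs_kernel_degree_le: "\<bar>kernel_degree y\<bar> \<le> B"
  unfolding kernel_degree_def by (intro abs_expectation_le K_bound)

lemma abs_codegree_le: "\<bar>codegree x z\<bar> \<le> B * B"
  unfolding codegree_def by (intro abs_expectation_le abs_K_mult_le K_bound)

lemma expectation_coordinate:
  fixes f :: "'a \<Rightarrow> real"
  assumes "i \<in> I" "f \<in> borel_measurable M"
  shows "(\<integral>x. f (x i) \<partial>P) = (\<integral>y. f y \<partial>M)"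
  using integral_distr[of "\<lambda>x. x i" P M f] distr_PiM_component[of I "\<lambda>_. M" i] prob_space_axioms assms
  by auto

text \<open>
  If the remaining factor \<open>R\<close> ignores the point \<open>v\<close>, averaging over that point replaces the pendant edge \<open>vw\<close>
  by the degree at \<open>w\<close>.
\<close>

lemma integrate_leaf:
  assumes "v \<in> I" "w \<in> I" "v \<noteq> w" and [measurable]: "R \<in> borel_measurable P"
    and "\<And>x. \<bar>R x\<bar> \<le> C" and R_upd: "\<And>x y. R (x(v := y)) = R x"
  shows "(\<integral>x. K (x v) (x w) * R x \<partial>P) = (\<integral>x. kernel_degree (x w) * R x \<partial>P)"
proof -
  have "(\<integral>x. K (x v) (x w) * R x \<partial>P) = (\<integral>x. (\<integral>y. K y (x w) * R x \<partial>M) \<partial>P)"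
    using assms(1-3) R_upd
    by (subst integrate_out[of _ "B * C" v]) (auto intro: abs_K_mult_le assms)
  then show ?thesis by (simp add: kernel_degree_def)
qed

lemma hom_density_leaf_eq_0:
  assumes S: "set S \<subseteq> I \<times> I" "\<forall>(i, j)\<in>set S. i \<noteq> j"
    and leaf: "incidence_count S v = 1"
    and regular: "AE y in M. kernel_degree y = 0"
  shows "hom_density S = 0"
proof -
  obtain S1 e S2 where S_eq: "S = S1 @ e # S2" and e: "fst e = v \<or> snd e = v"
    and rest: "incidence_count (S1 @ S2) v = 0"
    using leaf by (rule incidence_count_eq_1E)
  have "\<exists>w. w \<in> I \<and> v \<in> I \<and> v \<noteq> w \<and> (\<forall>x. K (x (fst e)) (x (snd e)) = K (x v) (x w))"
    using e S S_eq by (cases e) (auto simp: K_sym intro: exI[of _ "fst e"] exI[of _ "snd e"])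
  then obtain w where w: "w \<in> I" "v \<in> I" "v \<noteq> w"
    and K_e: "\<And>x. K (x (fst e)) (x (snd e)) = K (x v) (x w)" by metis
  define T where "T = S1 @ S2"
  have [measurable]: "edge_product T \<in> borel_measurable P"
    using S S_eq by (intro measurable_edge_product) (auto simp: T_def)
  have "hom_density S = (\<integral>x. K (x v) (x w) * edge_product T x \<partial>P)"
    unfolding hom_density_def
    by (intro Bochner_Integration.integral_cong) (simp_all add: S_eq T_def K_e mult_ac)
  also have "\<dots> = (\<integral>x. kernel_degree (x w) * edge_product T x \<partial>P)"
    using w rest by (intro integrate_leaf[OF _ _ _ _ abs_edge_product_le] edge_product_update) (auto simp: T_def[symmetric])
  also have "\<dots> = (\<integral>x. 0 \<partial>P)"
  proof (rule integral_cong_AE)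
    have "AE x in P. kernel_degree (x w) = 0"
      using AE_PiM_component[of I "\<lambda>_. M" w "\<lambda>y. kernel_degree y = 0"] prob_space_axioms w regular by auto
    then show "AE x in P. kernel_degree (x w) * edge_product T x = 0"
      by eventually_elim simp
  qed (use w in measurable)
  finally show ?thesis by simp
qed

definition degree_energy :: real where
  "degree_energy = (\<integral>y. (kernel_degree y)\<^sup>2 \<partial>M)"

lemma integral_kernel_degree:
  "(\<integral>y. kernel_degree y \<partial>M) = (\<integral>z. case_prod K z \<partial>(M \<Otimes>\<^sub>M M))"
  unfolding kernel_degree_def
proof (rule MM.integral_snd)
  show "integrable (M \<Otimes>\<^sub>M M) (case_prod K)"
    using K_measurable by (intro MM.integrable_const_bound[of _ B]) (auto simp: K_bound)
qed

lemma degree_energy_nonneg: "0 \<le> degree_energy"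
  by (simp add: degree_energy_def)

lemma degree_energy_eq_0_imp:
  assumes "degree_energy = 0"
  shows "AE y in M. kernel_degree y = 0"
proof -
  have "integrable M (\<lambda>y. (kernel_degree y)\<^sup>2)"
    using power_mono[OF abs_kernel_degree_le, where n = 2]
    by (intro integrable_const_bound[of _ "B\<^sup>2"]) auto
  then have "AE y in M. (kernel_degree y)\<^sup>2 = 0"
    using assms by (subst integral_nonneg_eq_0_iff_AE[symmetric]) (auto simp: degree_energy_def)
  then show ?thesis by simp
qed

lemma expectation_cherry:
  assumes "u \<in> I" "v \<in> I" "w \<in> I" "distinct [u, v, w]"
  shows "(\<integral>x. K (x u) (x v) * K (x v) (x w) \<partial>P) = degree_energy"
proof -
  have "(\<integral>x. K (x u) (x v) * K (x v) (x w) \<partial>P) = (\<integral>x. kernel_degree (x v) * K (x v) (x w) \<partial>P)"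
    using assms by (intro integrate_leaf[of _ _ _ B]) (auto simp: K_bound)
  also have "\<dots> = (\<integral>x. K (x w) (x v) * kernel_degree (x v) \<partial>P)"
    by (simp add: K_sym mult.commute)
  also have "\<dots> = (\<integral>x. kernel_degree (x v) * kernel_degree (x v) \<partial>P)"
    using assms by (intro integrate_leaf[of _ _ _ B]) (auto simp: abs_kernel_degree_le)
  also have "\<dots> = degree_energy"
    using assms expectation_coordinate[of v "\<lambda>y. kernel_degree y * kernel_degree y"]
    by (simp add: degree_energy_def power2_eq_square)
  finally show ?thesis .
qed

text \<open>
  Integrating out \<open>u\<close> and then \<open>v\<close> turns the edge \<open>uv\<close> into the mean of \<open>K\<close>, whatever the other edge does.
\<close>

lemma expectation_matching:
  assumes mean: "(\<integral>y. kernel_degree y \<partial>M) = 0"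
    and "u \<in> I" "v \<in> I" "w \<in> I" "z \<in> I" "distinct [u, v, w, z]"
  shows "(\<integral>x. K (x u) (x v) * K (x w) (x z) \<partial>P) = 0"
proof -
  have "(\<integral>x. K (x u) (x v) * K (x w) (x z) \<partial>P) = (\<integral>x. kernel_degree (x v) * K (x w) (x z) \<partial>P)"
    using assms by (intro integrate_leaf[of _ _ _ B]) (auto simp: K_bound)
  also have "\<dots> = (\<integral>x. (\<integral>y. kernel_degree y * K (x w) (x z) \<partial>M) \<partial>P)"
    using assms by (subst integrate_out[of _ "B * B" v])
      (auto simp: abs_mult intro!: mult_mono abs_kernel_degree_le K_bound B_nonneg)
  also have "\<dots> = 0" using mean by simp
  finally show ?thesis .
qed

definition C4_density :: real where
  "C4_density = (\<integral>(x, z). (codegree x z)\<^sup>2 \<partial>(M \<Otimes>\<^sub>M M))"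

text \<open>
  Given the opposite vertices \<open>a\<close> and \<open>c\<close>, the points \<open>b\<close> and \<open>d\<close> are independent, and each of them
  contributes the codegree of \<open>a\<close> and \<open>c\<close>.
\<close>

lemma expectation_C4:
  assumes "a \<in> I" "b \<in> I" "c \<in> I" "d \<in> I" and dist: "distinct [a, b, c, d]"
  shows "(\<integral>x. K (x a) (x b) * (K (x b) (x c) * (K (x c) (x d) * K (x d) (x a))) \<partial>P) = C4_density"
proof -
  have "(\<integral>x. K (x a) (x b) * (K (x b) (x c) * (K (x c) (x d) * K (x d) (x a))) \<partial>P)
    = (\<integral>x. (\<integral>y. (K (x a) y * K y (x c)) * (K (x c) (x d) * K (x d) (x a)) \<partial>M) \<partial>P)"
    using assms by (subst integrate_out[of _ "B * (B * (B * B))" b])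
      (auto intro!: abs_K_mult_le K_bound simp: mult.assoc)
  also have "\<dots> = (\<integral>x. codegree (x a) (x c) * (K (x c) (x d) * K (x d) (x a)) \<partial>P)"
    by (simp add: codegree_def)
  also have "\<dots> = (\<integral>x. (\<integral>y. codegree (x a) (x c) * (K (x a) y * K y (x c)) \<partial>M) \<partial>P)"
    using assms
    by (subst integrate_out[of _ "(B * B) * (B * B)" d])
      (auto simp: abs_mult K_sym mult.commute intro!: mult_mono abs_codegree_le K_bound B_nonneg)
  also have "\<dots> = (\<integral>x. (codegree (x a) (x c))\<^sup>2 \<partial>P)"
    by (simp add: codegree_def power2_eq_square)
  also have "\<dots> = C4_density"
    using assms expectation_pair_coordinates[of a c "\<lambda>(x, z). (codegree x z)\<^sup>2"]
    by (simp add: C4_density_def)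
  finally show ?thesis .
qed

lemma C4_density_nonneg: "0 \<le> C4_density"
  unfolding C4_density_def by (intro integral_nonneg_AE) auto

text \<open>
  If the 4-cycle density is zero, the codegree function vanishes almost everywhere. This does not give
  \<open>\<integral> K(x, y)\<^sup>2 dy = 0\<close> at once, because the diagonal may be a null set. Instead the codegree is averaged over
  \<open>A \<times> A\<close>: the result is the integral of the squared function \<open>z \<mapsto> \<integral>\<^sub>A K(y, z) dy\<close>, so this function vanishes
  almost everywhere for each measurable \<open>A\<close>. Hence \<open>K\<close> integrates to zero over every rectangle, and rectangles
  determine a measure on the product.
\<close>

lemma C4_density_eq_0_imp_AE_0:
  assumes ijk: "i \<in> I" "j \<in> I" "k \<in> I" "distinct [i, j, k]" and zero: "C4_density = 0"
  shows "AE z in M \<Otimes>\<^sub>M M. case_prod K z = 0"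
proof -
  have "integrable (M \<Otimes>\<^sub>M M) (\<lambda>z. (codegree (fst z) (snd z))\<^sup>2)"
    using power_mono[OF abs_codegree_le, where n = 2]
    by (intro MM.integrable_const_bound[of _ "(B * B)\<^sup>2"]) auto
  then have "AE z in M \<Otimes>\<^sub>M M. (codegree (fst z) (snd z))\<^sup>2 = 0"
    using zero by (subst integral_nonneg_eq_0_iff_AE[symmetric]) (auto simp: C4_density_def case_prod_beta')
  then have codeg0: "AE x in P. codegree (x i) (x j) = 0"
    using AE_pair_coordinates[of i j "\<lambda>z. (codegree (fst z) (snd z))\<^sup>2 = 0"] ijk by simp
  have deg0: "AE x in P. (\<integral>y. indicator A y * K y (x k) \<partial>M) = 0" if [measurable]: "A \<in> sets M" for A
  proof -
    let ?h = "\<lambda>z. \<integral>y. indicator A y * K y z \<partial>M"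
    let ?f = "\<lambda>x. indicator A (x i) * (indicator A (x j) * (K (x i) (x k) * K (x k) (x j)))"
    have ind_le: "\<bar>indicator A y * r\<bar> \<le> C" if "\<bar>r\<bar> \<le> C" for y :: 'a and r C :: real
      using that by (auto simp: indicator_def)
    have h_le: "\<bar>?h z\<bar> \<le> B" for z by (intro abs_expectation_le ind_le K_bound)
    have [measurable]: "?h \<in> borel_measurable M" by measurable
    have f_le: "\<bar>?f x\<bar> \<le> B * B" for x by (intro ind_le abs_K_mult_le K_bound)
    have "(\<integral>x. (?h (x k))\<^sup>2 \<partial>P) = (\<integral>x. (\<integral>y. indicator A y * K y (x k) * ?h (x k) \<partial>M) \<partial>P)"
      by (simp add: power2_eq_square)
    also have "\<dots> = (\<integral>x. indicator A (x j) * K (x j) (x k) * ?h (x k) \<partial>P)"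
      using ijk by (subst integrate_out[of "\<lambda>x. indicator A (x j) * K (x j) (x k) * ?h (x k)" "B * B" j])
        (auto simp: mult.assoc intro!: ind_le abs_K_mult_le h_le)
    also have "\<dots> = (\<integral>x. (\<integral>y. indicator A y * (indicator A (x j) * (K y (x k) * K (x k) (x j))) \<partial>M) \<partial>P)"
      by (simp add: K_sym mult_ac flip: integral_mult_right_zero)
    also have "\<dots> = (\<integral>x. ?f x \<partial>P)"
      using ijk by (subst integrate_out[OF _ f_le, where i = i]) auto
    also have "\<dots> = (\<integral>x. (\<integral>y. indicator A (x i) * (indicator A (x j) * (K (x i) y * K y (x j))) \<partial>M) \<partial>P)"
      using ijk by (subst integrate_out[OF _ f_le, where i = k]) auto
    also have "\<dots> = (\<integral>x. indicator A (x i) * (indicator A (x j) * codegree (x i) (x j)) \<partial>P)"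
      by (simp add: codegree_def)
    also have "\<dots> = (\<integral>x. 0 \<partial>P)"
      using codeg0 ijk by (intro integral_cong_AE) auto
    finally have "(\<integral>x. (?h (x k))\<^sup>2 \<partial>P) = 0" by simp
    moreover have "integrable P (\<lambda>x. (?h (x k))\<^sup>2)"
      using power_mono[OF h_le, where n = 2] ijk
      by (intro P.integrable_const_bound[of _ "B\<^sup>2"]) auto
    ultimately have "AE x in P. (?h (x k))\<^sup>2 = 0"
      by (subst integral_nonneg_eq_0_iff_AE[symmetric]) auto
    then show ?thesis by simp
  qed
  have rect0: "(\<integral>z. indicator (A \<times> A') z * case_prod K z \<partial>(M \<Otimes>\<^sub>M M)) = 0"
    if [measurable]: "A \<in> sets M" "A' \<in> sets M" for A A'
  proof -
    have "(\<integral>z. indicator (A \<times> A') z * case_prod K z \<partial>(M \<Otimes>\<^sub>M M))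
      = (\<integral>x. indicator (A \<times> A') (x i, x k) * K (x i) (x k) \<partial>P)"
      using ijk K_measurable by (subst expectation_pair_coordinates[of i k, symmetric]) auto
    also have "\<dots> = (\<integral>x. indicator A' (x k) * (indicator A (x i) * K (x i) (x k)) \<partial>P)"
      by (simp add: indicator_times mult_ac)
    also have "\<dots> = (\<integral>x. (\<integral>y. indicator A' (x k) * (indicator A y * K y (x k)) \<partial>M) \<partial>P)"
      using ijk by (subst integrate_out[of _ B i]) (auto simp: indicator_def intro: K_bound B_nonneg)
    also have "\<dots> = (\<integral>x. indicator A' (x k) * (\<integral>y. indicator A y * K y (x k) \<partial>M) \<partial>P)"
      by simp
    also have "\<dots> = (\<integral>x. 0 \<partial>P)"
      using deg0[OF \<open>A \<in> sets M\<close>] ijk by (intro integral_cong_AE) auto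
    finally show ?thesis by simp
  qed
  (* A signed density does not define a measure; 1 + K / (B + 1) is nonnegative, and vanishing rectangle
     integrals of K say that it has the same rectangle masses as the constant density 1. *)
  let ?w = "\<lambda>z. 1 + case_prod K z / (B + 1)"
  have w_nonneg: "0 \<le> ?w z" for z
    using K_bound[of "fst z" "snd z"] by (simp add: case_prod_beta' field_simps)
  have int_K: "integrable (M \<Otimes>\<^sub>M M) (\<lambda>z. indicator (A \<times> A') z * case_prod K z)"
    if [measurable]: "A \<in> sets M" "A' \<in> sets M" for A A'
    using K_measurable
    by (intro MM.integrable_const_bound[of _ B]) (auto simp: indicator_def K_bound B_nonneg)
  have "M \<Otimes>\<^sub>M M = density (M \<Otimes>\<^sub>M M) (\<lambda>z. ennreal (?w z))"
  proof (rule pair_measure_eqI)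
    fix A A' assume A [measurable]: "A \<in> sets M" "A' \<in> sets M"
    have split_w: "indicator (A \<times> A') z * ?w z
      = indicator (A \<times> A') z + indicator (A \<times> A') z * case_prod K z / (B + 1)" for z
      by (simp add: algebra_simps)
    have int_ind: "integrable (M \<Otimes>\<^sub>M M) (\<lambda>z. indicator (A \<times> A') z :: real)"
      by (intro MM.integrable_const_bound[of _ 1]) auto
    have int_w: "integrable (M \<Otimes>\<^sub>M M) (\<lambda>z. indicator (A \<times> A') z * ?w z)"
      unfolding split_w by (intro Bochner_Integration.integrable_add Bochner_Integration.integrable_divide int_K int_ind A)
    have "emeasure (density (M \<Otimes>\<^sub>M M) (\<lambda>z. ennreal (?w z))) (A \<times> A')
      = (\<integral>\<^sup>+z. ennreal (indicator (A \<times> A') z * ?w z) \<partial>(M \<Otimes>\<^sub>M M))"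
      using K_measurable by (subst emeasure_density) (auto intro!: nn_integral_cong simp: indicator_def)
    also have "\<dots> = ennreal (\<integral>z. indicator (A \<times> A') z * ?w z \<partial>(M \<Otimes>\<^sub>M M))"
      using w_nonneg by (intro nn_integral_eq_integral int_w AE_I2) (auto simp: indicator_def)
    also have "(\<integral>z. indicator (A \<times> A') z * ?w z \<partial>(M \<Otimes>\<^sub>M M)) = measure (M \<Otimes>\<^sub>M M) (A \<times> A')"
      by (simp add: split_w int_K int_ind rect0)
    also have "ennreal \<dots> = emeasure M A * emeasure M A'"
      by (simp add: MM.emeasure_eq_measure[symmetric] emeasure_pair_measure_Times)
    finally show "emeasure M A * emeasure M A' = emeasure (density (M \<Otimes>\<^sub>M M) (\<lambda>z. ennreal (?w z))) (A \<times> A')"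
      by simp
  qed (auto intro: sigma_finite_measure_axioms)
  then have "density (M \<Otimes>\<^sub>M M) (\<lambda>z. 1) = density (M \<Otimes>\<^sub>M M) (\<lambda>z. ennreal (?w z))"
    by (simp add: density_1)
  then have "AE z in M \<Otimes>\<^sub>M M. 1 = ennreal (?w z)"
    using K_measurable MM.emeasure_space_1
    by (subst (asm) finite_density_unique) auto
  then show ?thesis
  proof eventually_elim
    case (elim z)
    then have "?w z = 1" using ennreal_eq_1[of "?w z"] by metis
    then show ?case using B_nonneg by simp
  qed
qed

end

section \<open>The signed expansion over subgraphs of the complete graph on five vertices\<close>

text \<open>
  The recursion follows Pascal's rule: a sublist either contains the first element or it does not. This is
  also how the coefficients of the product below arise.
\<close>

fun sublists_of_length :: "nat \<Rightarrow> 'e list \<Rightarrow> 'e list list" where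
  "sublists_of_length 0 es = [[]]"
| "sublists_of_length (Suc k) [] = []"
| "sublists_of_length (Suc k) (e # es) = map (Cons e) (sublists_of_length k es) @ sublists_of_length (Suc k) es"

lemma sublists_of_lengthD:
  assumes "S \<in> set (sublists_of_length k es)"
  shows "set S \<subseteq> set es \<and> length S = k \<and> (distinct es \<longrightarrow> distinct S)"
  using assms
proof (induction k es arbitrary: S rule: sublists_of_length.induct)
  case (3 k e es)
  from "3.prems" consider T where "S = e # T" "T \<in> set (sublists_of_length k es)"
    | "S \<in> set (sublists_of_length (Suc k) es)" by auto
  then show ?case
  proof cases
    case 1
    then show ?thesis using "3.IH"(1)[of T] by auto
  next
    case 2
    then show ?thesis using "3.IH"(2)[of S] by auto
  qed
qed auto

lemma prod_list_one_plus:
  fixes g :: "'e \<Rightarrow> 'b :: comm_semiring_1"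
  shows "length es \<le> n \<Longrightarrow>
    (\<Prod>e\<leftarrow>es. 1 + a * g e) = (\<Sum>k\<le>n. a ^ k * (\<Sum>S\<leftarrow>sublists_of_length k es. \<Prod>e\<leftarrow>S. g e))"
proof (induction es arbitrary: n)
  case Nil
  have "sublists_of_length k ([] :: 'e list) = (if k = 0 then [[]] else [])" for k :: nat
    by (cases k) auto
  then have "(\<Sum>k\<le>n. a ^ k * (\<Sum>S\<leftarrow>sublists_of_length k []. \<Prod>e\<leftarrow>S. g e)) = (\<Sum>k\<le>n. if k = 0 then 1 else 0)"
    by (intro sum.cong) auto
  then show ?case by simp
next
  case (Cons e es)
  then obtain m where n: "n = Suc m" and m: "length es \<le> m" by (cases n) auto
  let ?c = "\<lambda>k. \<Sum>S\<leftarrow>sublists_of_length k es. \<Prod>e\<leftarrow>S. g e"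
  have "(\<Sum>k\<le>n. a ^ k * (\<Sum>S\<leftarrow>sublists_of_length k (e # es). \<Prod>e\<leftarrow>S. g e))
    = 1 + (\<Sum>k\<le>m. a ^ Suc k * (g e * ?c k + ?c (Suc k)))"
    unfolding n by (subst sum.atMost_Suc_shift) (simp add: comp_def sum_list_const_mult)
  also have "\<dots> = a * g e * (\<Sum>k\<le>m. a ^ k * ?c k) + (1 + (\<Sum>k\<le>m. a ^ Suc k * ?c (Suc k)))"
    by (simp add: sum.distrib sum_distrib_left algebra_simps)
  also have "1 + (\<Sum>k\<le>m. a ^ Suc k * ?c (Suc k)) = (\<Sum>k\<le>n. a ^ k * ?c k)"
    unfolding n by (subst sum.atMost_Suc_shift) simp
  also have "a * g e * (\<Sum>k\<le>m. a ^ k * ?c k) + (\<Sum>k\<le>n. a ^ k * ?c k) = (\<Prod>f\<leftarrow>e # es. 1 + a * g f)"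
  proof -
    have "length es \<le> n" using m n by simp
    then show ?thesis
      by (simp only: Cons.IH[OF m, symmetric] Cons.IH[of n, symmetric]) (simp add: algebra_simps)
  qed
  finally show ?case by simp
qed

lemma integral_sum_list:
  fixes f :: "'e \<Rightarrow> 'x \<Rightarrow> real"
  assumes "\<And>e. e \<in> set es \<Longrightarrow> integrable N (f e)"
  shows "(\<integral>x. (\<Sum>e\<leftarrow>es. f e x) \<partial>N) = (\<Sum>e\<leftarrow>es. \<integral>x. f e x \<partial>N)"
    and "integrable N (\<lambda>x. \<Sum>e\<leftarrow>es. f e x)"
proof -
  have "(\<integral>x. (\<Sum>e\<leftarrow>es. f e x) \<partial>N) = (\<Sum>e\<leftarrow>es. \<integral>x. f e x \<partial>N)
    \<and> integrable N (\<lambda>x. \<Sum>e\<leftarrow>es. f e x)"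
    using assms by (induction es) auto
  then show "(\<integral>x. (\<Sum>e\<leftarrow>es. f e x) \<partial>N) = (\<Sum>e\<leftarrow>es. \<integral>x. f e x \<partial>N)"
    "integrable N (\<lambda>x. \<Sum>e\<leftarrow>es. f e x)" by auto
qed

definition K5_edges :: "(nat \<times> nat) list" where
  "K5_edges = [(1,2), (1,3), (1,4), (1,5), (2,3), (2,4), (2,5), (3,4), (3,5), (4,5)]"

definition C5_sign :: "nat \<times> nat \<Rightarrow> int" where
  "C5_sign e = (if e \<in> set [(1,2), (2,3), (3,4), (4,5), (1,5)] then 1 else -1)"

abbreviation graph_sign :: "(nat \<times> nat) list \<Rightarrow> int" where
  "graph_sign S \<equiv> \<Prod>e\<leftarrow>S. C5_sign e"

abbreviation K5_subgraphs :: "nat \<Rightarrow> (nat \<times> nat) list list" where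
  "K5_subgraphs k \<equiv> sublists_of_length k K5_edges"

text \<open>Two edges form a cherry if they share a vertex.\<close>

definition is_cherry :: "(nat \<times> nat) list \<Rightarrow> bool" where
  "is_cherry S \<longleftrightarrow> (\<exists>v\<in>set [1,2,3,4,5]. incidence_count S v = 2)"

definition has_leaf :: "(nat \<times> nat) list \<Rightarrow> bool" where
  "has_leaf S \<longleftrightarrow> (\<exists>v\<in>set [1,2,3,4,5]. incidence_count S v = 1)"

text \<open>
  Every vertex is incident with two edges of sign \<open>+1\<close> and two of sign \<open>-1\<close>. The products of the six pairs of
  edges at a vertex thus sum to \<open>(0\<^sup>2 - 4) / 2 = -2\<close>, and there are five vertices.
\<close>

lemma cherry_sign_sum:
  "(\<Sum>S\<leftarrow>K5_subgraphs 2. if is_cherry S then graph_sign S else 0) = -10"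
  by code_simp

text \<open>
  Behind this count: deleting a vertex leaves a \<open>K\<^sub>4\<close> with three edges of each sign, so the sign of a 4-cycle in
  it is minus the sign of the complementary perfect matching. Both signs form a path, so two of the matchings
  have sign \<open>+1\<close> and one has sign \<open>-1\<close>. The three 4-cycles contribute \<open>-1\<close>, for each of the five vertices.
\<close>

lemma leafless_sign_sum:
  "(\<Sum>S\<leftarrow>K5_subgraphs 4. if has_leaf S then 0 else graph_sign S) = -5"
  by code_simp

text \<open>
  The 4-cycles \<open>pqrs\<close>, \<open>pqsr\<close> and \<open>prqs\<close> on vertices \<open>p < q < r < s\<close>, with their edges in the order of
  \<open>K5_edges\<close>, so that they can be compared with sublists of it.
\<close>

definition four_cycles :: "nat \<times> nat \<times> nat \<times> nat \<Rightarrow> (nat \<times> nat) list list" where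
  "four_cycles = (\<lambda>(p, q, r, s).
     [[(p, q), (p, s), (q, r), (r, s)], [(p, q), (p, r), (q, s), (r, s)], [(p, r), (p, s), (q, r), (q, s)]])"

definition four_sets :: "(nat \<times> nat \<times> nat \<times> nat) list" where
  "four_sets = [(1,2,3,4), (1,2,3,5), (1,2,4,5), (1,3,4,5), (2,3,4,5)]"

lemma leafless_imp_C4:
  "\<forall>S\<in>set (K5_subgraphs 4). has_leaf S \<or> S \<in> set (concat (map four_cycles four_sets))"
  by code_simp

lemma of_int_sum_list_eq: "of_int (\<Sum>x\<leftarrow>xs. f x) = (\<Sum>x\<leftarrow>xs. of_int (f x))"
  by (induction xs) auto

lemma K5_subgraphsD:
  assumes "S \<in> set (K5_subgraphs k)"
  shows "set S \<subseteq> {1..5} \<times> {1..5}" "\<forall>(i, j)\<in>set S. i < j" "distinct S" "length S = k"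
proof -
  have S: "set S \<subseteq> set K5_edges" "length S = k" "distinct K5_edges \<longrightarrow> distinct S"
    using sublists_of_lengthD[OF assms] by blast+
  have "set K5_edges \<subseteq> {1..5} \<times> {1..5}" "\<forall>(i, j)\<in>set K5_edges. i < j" "distinct K5_edges"
    by (simp_all add: K5_edges_def)
  then show "set S \<subseteq> {1..5} \<times> {1..5}" "\<forall>(i, j)\<in>set S. i < j" "distinct S" "length S = k"
    using S by blast+
qed

locale kernel_on_5_points = bounded_symmetric_kernel M K B I
  for M :: "'a measure" and K and B and I :: "nat set" +
  assumes I_eq: "I = {1..5}"
begin

text \<open>At \<open>a = 2 \<epsilon>\<close> this is \<open>1024\<close> times the density of the pentagon in \<open>1/2 + \<epsilon> K\<close>.\<close>

definition signed_expectation :: "real \<Rightarrow> real" where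
  "signed_expectation a = (\<integral>x. (\<Prod>e\<leftarrow>K5_edges. 1 + a * (C5_sign e * K (x (fst e)) (x (snd e)))) \<partial>P)"

definition coefficient :: "nat \<Rightarrow> real" where
  "coefficient k = (\<Sum>S\<leftarrow>K5_subgraphs k. graph_sign S * hom_density S)"

lemma prod_list_signed: "(\<Prod>e\<leftarrow>S. real_of_int (C5_sign e) * K (x (fst e)) (x (snd e))) = graph_sign S * edge_product S x"
  by (induction S) (auto simp: mult_ac)

lemma integrable_edge_product:
  assumes "set S \<subseteq> I \<times> I"
  shows "integrable P (edge_product S)"
  using assms abs_edge_product_le
  by (intro P.integrable_const_bound[of _ "B ^ length S"] measurable_edge_product) auto

lemma length_K5_edges: "length K5_edges = 10"
  by (simp add: K5_edges_def)

lemma measurable_signed_product: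
  assumes "set es \<subseteq> I \<times> I"
  shows "(\<lambda>x. \<Prod>e\<leftarrow>es. 1 + a * (real_of_int (C5_sign e) * K (x (fst e)) (x (snd e)))) \<in> borel_measurable P"
  using assms
proof (induction es)
  case (Cons e es)
  then have "fst e \<in> I" "snd e \<in> I" by auto
  then show ?case using Cons by simp
qed simp

lemma signed_expectation_expand: "signed_expectation a = (\<Sum>k\<le>10. a ^ k * coefficient k)"
proof -
  have int: "integrable P (\<lambda>x. real_of_int (graph_sign S) * edge_product S x)" if "S \<in> set (K5_subgraphs k)" for S k
    using integrable_edge_product K5_subgraphsD(1)[OF that] I_eq by auto
  have "signed_expectation a
    = (\<integral>x. (\<Sum>k\<le>10. a ^ k * (\<Sum>S\<leftarrow>K5_subgraphs k. graph_sign S * edge_product S x)) \<partial>P)"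
    unfolding signed_expectation_def
    by (subst prod_list_one_plus[of K5_edges 10]) (simp_all only: length_K5_edges prod_list_signed order_refl)
  also have "\<dots> = (\<Sum>k\<le>10. a ^ k * coefficient k)"
    unfolding coefficient_def hom_density_def
    by (subst Bochner_Integration.integral_sum)
      (simp_all add: integral_sum_list[OF int] del: integrable_mult_right_iff)
  finally show ?thesis .
qed

text \<open>
  The relabelling \<open>\<pi>\<close> is multiplication by 2 modulo 5. It maps the pentagon to its complement and the
  complement to the pentagon, and it preserves \<open>P\<close>.
\<close>

lemma signed_expectation_even: "signed_expectation (- a) = signed_expectation a"
proof -
  define \<pi> :: "nat \<Rightarrow> nat" where "\<pi> = (\<lambda>i. if i = 1 then 2 else if i = 2 then 4 else if i = 3 then 1 else if i = 4 then 3 else 5)"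
  have \<pi>: "inj_on \<pi> I" "\<pi> \<in> I \<rightarrow> I"
    by (auto simp: \<pi>_def I_eq inj_on_def)
  let ?f = "\<lambda>x. \<Prod>e\<leftarrow>K5_edges. 1 + a * (C5_sign e * K (x (fst e)) (x (snd e)))"
  have f: "?f \<in> borel_measurable P"
    by (rule measurable_signed_product) (simp add: K5_edges_def I_eq)
  have "signed_expectation a = (\<integral>x. ?f x \<partial>distr P P (\<lambda>x. \<lambda>n\<in>I. x (\<pi> n)))"
    unfolding signed_expectation_def using distr_PiM_reindex[OF _ \<pi>, of "\<lambda>_. M"] prob_space_axioms by simp
  also have "\<dots> = (\<integral>x. ?f (\<lambda>n\<in>I. x (\<pi> n)) \<partial>P)"
    using \<pi>(2) by (intro integral_distr f measurable_restrict measurable_component_singleton) auto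
  also have "\<dots> = signed_expectation (- a)"
    unfolding signed_expectation_def
  proof (rule Bochner_Integration.integral_cong[OF refl])
    fix x :: "nat \<Rightarrow> 'a"
    show "?f (\<lambda>n\<in>I. x (\<pi> n)) = (\<Prod>e\<leftarrow>K5_edges. 1 + - a * (C5_sign e * K (x (fst e)) (x (snd e))))"
      using K_sym[of "x 2" "x 1"] K_sym[of "x 4" "x 1"] K_sym[of "x 4" "x 3"]
      by (simp add: K5_edges_def C5_sign_def I_eq \<pi>_def)
  qed
  finally show ?thesis ..
qed

lemma coefficient_0: "coefficient 0 = 1"
  by (simp add: coefficient_def hom_density_def P.prob_space)

lemma coefficient_2:
  assumes mean: "(\<integral>y. kernel_degree y \<partial>M) = 0"
  shows "coefficient 2 = -10 * degree_energy"
proof -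
  have "hom_density S = (if is_cherry S then degree_energy else 0)" if S: "S \<in> set (K5_subgraphs 2)" for S
  proof -
    obtain i j k l where S_eq: "S = [(i, j), (k, l)]"
      using K5_subgraphsD(4)[OF S] by (auto simp: numeral_2_eq_2 length_Suc_conv)
    have ij: "i \<in> I" "j \<in> I" "k \<in> I" "l \<in> I" "i < j" "k < l" "i \<noteq> k \<or> j \<noteq> l"
      using K5_subgraphsD[OF S] by (auto simp: S_eq I_eq)
    have dens: "hom_density S = (\<integral>x. K (x i) (x j) * K (x k) (x l) \<partial>P)"
      unfolding hom_density_def by (intro Bochner_Integration.integral_cong) (simp_all add: S_eq)
    have cherry: "is_cherry S \<longleftrightarrow> i = k \<or> i = l \<or> j = k \<or> j = l"
    proof
      assume "is_cherry S"
      then obtain v where "incidence_count S v = 2" unfolding is_cherry_def by blast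
      then show "i = k \<or> i = l \<or> j = k \<or> j = l"
        using ij by (cases "i = v"; cases "j = v"; cases "k = v"; cases "l = v") (auto simp: S_eq)
    next
      assume shared: "i = k \<or> i = l \<or> j = k \<or> j = l"
      have "set [1,2,3,4,5] = I" by (auto simp: I_eq)
      moreover have "\<exists>v\<in>I. incidence_count S v = 2"
        using shared ij by (auto simp: S_eq)
      ultimately show "is_cherry S" unfolding is_cherry_def by blast
    qed
    consider "i = k" | "i = l" | "j = k" | "j = l" | "i \<noteq> k \<and> i \<noteq> l \<and> j \<noteq> k \<and> j \<noteq> l" by blast
    then show ?thesis
    proof cases
      case 1
      then show ?thesis using ij cherry dens expectation_cherry[of j i l] by (simp add: K_sym[of "_ j" "_ k"])
    next
      case 2
      then show ?thesis using ij cherry dens expectation_cherry[of j i k] by (simp add: K_sym[of "_ l" "_ j"] K_sym[of "_ l" "_ k"])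
    next
      case 3
      then show ?thesis using ij cherry dens expectation_cherry[of i j l] by simp
    next
      case 4
      then show ?thesis using ij cherry dens expectation_cherry[of i j k] by (simp add: K_sym[of "_ l" "_ k"])
    next
      case 5
      then show ?thesis using ij cherry dens expectation_matching[OF mean, of i j k l] by simp
    qed
  qed
  then have "coefficient 2 = (\<Sum>S\<leftarrow>K5_subgraphs 2. real_of_int (if is_cherry S then graph_sign S else 0) * degree_energy)"
    unfolding coefficient_def by (intro arg_cong[where f = sum_list] map_cong) auto
  also have "\<dots> = real_of_int (\<Sum>S\<leftarrow>K5_subgraphs 2. if is_cherry S then graph_sign S else 0) * degree_energy"
    by (simp only: sum_list_mult_const of_int_sum_list_eq)
  finally show ?thesis by (simp add: cherry_sign_sum)
qed

lemma coefficient_4: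
  assumes regular: "AE y in M. kernel_degree y = 0"
  shows "coefficient 4 = -5 * C4_density"
proof -
  have "hom_density S = (if has_leaf S then 0 else C4_density)" if S: "S \<in> set (K5_subgraphs 4)" for S
  proof (cases "has_leaf S")
    case True
    then obtain v where "incidence_count S v = 1" unfolding has_leaf_def by blast
    then have "hom_density S = 0"
      using K5_subgraphsD[OF S] regular by (intro hom_density_leaf_eq_0) (auto simp: I_eq)
    then show ?thesis using True by simp
  next
    case False
    then obtain p q r s where pqrs: "(p, q, r, s) \<in> set four_sets" and S4: "S \<in> set (four_cycles (p, q, r, s))"
      using leafless_imp_C4 S by auto
    have vs: "p \<in> I" "q \<in> I" "r \<in> I" "s \<in> I" "distinct [p, q, r, s]"
      using pqrs by (auto simp: four_sets_def I_eq)
    from S4 consider "S = [(p, q), (p, s), (q, r), (r, s)]" | "S = [(p, q), (p, r), (q, s), (r, s)]"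
      | "S = [(p, r), (p, s), (q, r), (q, s)]"
      by (auto simp: four_cycles_def)
    then have "hom_density S = C4_density"
    proof cases
      case 1
      have "edge_product S x = K (x p) (x q) * (K (x q) (x r) * (K (x r) (x s) * K (x s) (x p)))" for x
        using K_sym[of "x s" "x p"] by (simp add: 1)
      then show ?thesis using vs expectation_C4[of p q r s] by (simp add: hom_density_def)
    next
      case 2
      have "edge_product S x = K (x p) (x q) * (K (x q) (x s) * (K (x s) (x r) * K (x r) (x p)))" for x
        using K_sym[of "x s" "x r"] K_sym[of "x r" "x p"] by (simp add: 2)
      then show ?thesis using vs expectation_C4[of p q s r] by (simp add: hom_density_def)
    next
      case 3
      have "edge_product S x = K (x p) (x r) * (K (x r) (x q) * (K (x q) (x s) * K (x s) (x p)))" for x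
        using K_sym[of "x r" "x q"] K_sym[of "x s" "x p"] by (simp add: 3)
      then show ?thesis using vs expectation_C4[of p r q s] by (simp add: hom_density_def)
    qed
    then show ?thesis using False by simp
  qed
  then have "coefficient 4 = (\<Sum>S\<leftarrow>K5_subgraphs 4. real_of_int (if has_leaf S then 0 else graph_sign S) * C4_density)"
    unfolding coefficient_def by (intro arg_cong[where f = sum_list] map_cong) auto
  also have "\<dots> = real_of_int (\<Sum>S\<leftarrow>K5_subgraphs 4. if has_leaf S then 0 else graph_sign S) * C4_density"
    by (simp only: sum_list_mult_const of_int_sum_list_eq)
  finally show ?thesis by (simp add: leafless_sign_sum)
qed

end

section \<open>From Lebesgue measurable to Borel measurable kernels\<close>

abbreviation unit_measure :: "real measure" where
  "unit_measure \<equiv> restrict_space lborel {0..1}"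

lemma prob_space_unit_measure: "prob_space unit_measure"
  by (rule prob_spaceI) (simp add: space_restrict_space emeasure_restrict_space)

text \<open>
  Identifies the law of a pair of points with planar Lebesgue measure on the unit square, which is where
  kernels are given.
\<close>

lemma unit_measure_pair: "unit_measure \<Otimes>\<^sub>M unit_measure = restrict_space lborel unit_square"
proof (rule pair_measure_eqI)
  have id_meas: "(\<lambda>z. z) \<in> measurable (unit_measure \<Otimes>\<^sub>M unit_measure) (lborel \<Otimes>\<^sub>M lborel)"
  proof -
    have "fst \<in> measurable (unit_measure \<Otimes>\<^sub>M unit_measure) lborel"
         "snd \<in> measurable (unit_measure \<Otimes>\<^sub>M unit_measure) lborel"
      using measurable_compose[OF measurable_fst measurable_restrict_space1[OF measurable_ident, of lborel "{0..1}"]]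
        measurable_compose[OF measurable_snd measurable_restrict_space1[OF measurable_ident, of lborel "{0..1}"]]
      by (simp_all add: id_def)
    then show ?thesis using measurable_Pair[of fst "unit_measure \<Otimes>\<^sub>M unit_measure" lborel snd lborel] by simp
  qed
  have sq: "unit_square \<in> sets (lborel :: (real \<times> real) measure)"
    by (simp add: borel_closed closed_Times)
  show sets_eq: "sets (unit_measure \<Otimes>\<^sub>M unit_measure) = sets (restrict_space lborel unit_square)"
  proof
    show "sets (unit_measure \<Otimes>\<^sub>M unit_measure) \<subseteq> sets (restrict_space lborel unit_square)"
    proof (rule sets_pair_in_sets)
      fix A B assume "A \<in> sets unit_measure" "B \<in> sets unit_measure"
      then show "A \<times> B \<in> sets (restrict_space lborel unit_square)"
        using sq by (auto simp: sets_restrict_space_iff borel_prod[symmetric])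
    qed
    show "sets (restrict_space lborel unit_square) \<subseteq> sets (unit_measure \<Otimes>\<^sub>M unit_measure)"
    proof
      fix C assume "C \<in> sets (restrict_space lborel unit_square)"
      then have C: "C \<subseteq> unit_square" "C \<in> sets (lborel \<Otimes>\<^sub>M lborel)"
        using sq unfolding lborel_prod by (auto simp: sets_restrict_space_iff)
      then have "(\<lambda>z. z) -` C \<inter> space (unit_measure \<Otimes>\<^sub>M unit_measure) \<in> sets (unit_measure \<Otimes>\<^sub>M unit_measure)"
        using id_meas by (intro measurable_sets)
      then show "C \<in> sets (unit_measure \<Otimes>\<^sub>M unit_measure)"
        using C(1) by (simp add: space_pair_measure space_restrict_space Int_absorb2)
    qed
  qed
  fix A B assume "A \<in> sets unit_measure" "B \<in> sets unit_measure"
  then have AB: "A \<in> sets lborel" "B \<in> sets lborel" "A \<subseteq> {0..1}" "B \<subseteq> {0..1}"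
    by (auto simp: sets_restrict_space_iff)
  then have "A \<times> B \<subseteq> unit_square" by auto
  then show "emeasure unit_measure A * emeasure unit_measure B = emeasure (restrict_space lborel unit_square) (A \<times> B)"
    using AB sq by (simp add: emeasure_restrict_space lborel.emeasure_pair_measure_Times flip: lborel_prod)
qed (use prob_space_unit_measure prob_space_imp_sigma_finite in auto)

lemma AE_lebesgue_on_iff:
  "(AE z in lebesgue_on unit_square. Q z) \<longleftrightarrow> (AE z in unit_measure \<Otimes>\<^sub>M unit_measure. Q z)"
  unfolding unit_measure_pair
  by (subst (1 2) AE_restrict_space_iff) (auto simp: AE_completion_iff borel_closed closed_Times)

text \<open>
  A Borel function almost everywhere equal to \<open>\<Delta>\<close> need be neither symmetric nor bounded. Averaging it with its
  reflection and truncating repairs both, and changes it only on a null set because reflection preserves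
  Lebesgue measure.
\<close>

lemma borel_version_of_kernel:
  assumes "is_kernel \<Delta>"
  obtains K B where "bounded_symmetric_kernel unit_measure K B {1..5::nat}"
    and "AE z in unit_measure \<Otimes>\<^sub>M unit_measure. \<Delta> z = case_prod K z"
proof -
  have sq: "unit_square \<in> sets (lborel :: (real \<times> real) measure)"
    by (simp add: borel_closed closed_Times)
  define g0 where "g0 z = indicator unit_square z *\<^sub>R \<Delta> z" for z
  have "g0 \<in> borel_measurable lebesgue"
    using assms sq unfolding is_kernel_def g0_def[abs_def]
    by (subst borel_measurable_restrict_space_iff[symmetric]) auto
  then obtain g where g: "g \<in> borel_measurable lborel" and g_eq: "AE z in lborel. g0 z = g z"
    using completion_ex_borel_measurable_real by blast
  obtain B where B: "\<And>z. z \<in> unit_square \<Longrightarrow> \<bar>\<Delta> z\<bar> \<le> B"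
    using assms unfolding is_kernel_def bounded_iff by force
  then have "0 \<le> B" using order_trans[OF abs_ge_zero B[of "(0, 0)"]] by simp
  let ?swap = "\<lambda>(x, y). (y, x) :: real \<times> real"
  have swap: "distr lborel lborel ?swap = (lborel :: (real \<times> real) measure)"
    using lborel_pair.distr_pair_swap unfolding lborel_prod by (rule sym)
  have swap_measurable: "?swap \<in> measurable lborel lborel"
    using measurable_pair_swap'[of lborel lborel] unfolding lborel_prod .
  have "AE z in distr lborel lborel ?swap. g0 z = g z"
    using g_eq by (simp only: swap)
  from AE_distrD[OF swap_measurable this]
  have g_eq_swap: "AE z in lborel. g0 (?swap z) = g (?swap z)" .
  define K where "K x y = max (- B) (min B ((g (x, y) + g (y, x)) / 2))" for x y
  have reflected: "(\<lambda>z. g (snd z, fst z)) \<in> borel_measurable lborel"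
    using measurable_compose[OF swap_measurable g] by (simp add: case_prod_beta')
  have "case_prod K = (\<lambda>z. max (- B) (min B ((g z + g (snd z, fst z)) / 2)))"
    by (simp add: K_def case_prod_beta')
  then have "case_prod K \<in> borel_measurable lborel"
    by (simp only:) (intro borel_measurable_max borel_measurable_min borel_measurable_const
      borel_measurable_divide borel_measurable_add g reflected)
  then have "case_prod K \<in> borel_measurable (unit_measure \<Otimes>\<^sub>M unit_measure)"
    unfolding unit_measure_pair by (rule measurable_restrict_space1)
  then have "bounded_symmetric_kernel unit_measure K B {1..5::nat}"
    using prob_space_unit_measure \<open>0 \<le> B\<close>
    unfolding bounded_symmetric_kernel_def bounded_symmetric_kernel_axioms_def
    by (auto simp: K_def add.commute)
  moreover have "AE z in unit_measure \<Otimes>\<^sub>M unit_measure. \<Delta> z = case_prod K z"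
  proof -
    have "AE z in lborel. z \<in> unit_square \<longrightarrow> \<Delta> z = case_prod K z"
      using g_eq g_eq_swap
    proof eventually_elim
      case (elim z)
      obtain x y where z: "z = (x, y)" by (cases z)
      show ?case
      proof
        assume "z \<in> unit_square"
        then have "g (x, y) = \<Delta> (x, y)" "g (y, x) = \<Delta> (y, x)" "\<Delta> (y, x) = \<Delta> (x, y)"
          using elim assms by (auto simp: z g0_def is_kernel_def)
        then show "\<Delta> z = case_prod K z" using B[OF \<open>z \<in> unit_square\<close>] by (auto simp: K_def z)
      qed
    qed
    then show ?thesis unfolding unit_measure_pair using sq by (subst AE_restrict_space_iff) auto
  qed
  ultimately show ?thesis using that by blast
qed

lemma integral_lebesgue_on_eq:
  fixes f :: "real \<times> real \<Rightarrow> real"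
  assumes g: "g \<in> borel_measurable (unit_measure \<Otimes>\<^sub>M unit_measure)" and f: "f \<in> borel_measurable (lebesgue_on unit_square)"
    and eq: "AE z in unit_measure \<Otimes>\<^sub>M unit_measure. f z = g z"
  shows "(\<integral>z. f z \<partial>lebesgue_on unit_square) = (\<integral>z. g z \<partial>(unit_measure \<Otimes>\<^sub>M unit_measure))"
proof -
  have sq: "unit_square \<in> sets (lborel :: (real \<times> real) measure)"
    by (simp add: borel_closed closed_Times)
  have g_b: "(\<lambda>z. indicator unit_square z *\<^sub>R g z) \<in> borel_measurable lborel"
    using g sq unfolding unit_measure_pair by (subst borel_measurable_restrict_space_iff[symmetric]) auto
  have f_b: "(\<lambda>z. indicator unit_square z *\<^sub>R f z) \<in> borel_measurable lebesgue"
    using f sq by (subst borel_measurable_restrict_space_iff[symmetric]) auto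
  have "AE z in lborel. z \<in> unit_square \<longrightarrow> f z = g z"
    using eq sq unfolding unit_measure_pair by (subst (asm) AE_restrict_space_iff) auto
  then have ae: "AE z in lebesgue. indicator unit_square z *\<^sub>R f z = indicator unit_square z *\<^sub>R g z"
    unfolding AE_completion_iff
  proof eventually_elim
    case (elim z)
    then show ?case by (cases "z \<in> unit_square") simp_all
  qed
  have "(\<integral>z. f z \<partial>lebesgue_on unit_square) = (\<integral>z. indicator unit_square z *\<^sub>R f z \<partial>lebesgue)"
    using sq by (intro integral_restrict_space) auto
  also have "\<dots> = (\<integral>z. indicator unit_square z *\<^sub>R g z \<partial>lebesgue)"
    by (rule integral_cong_AE[OF f_b measurable_completion[OF g_b] ae])
  also have "\<dots> = (\<integral>z. indicator unit_square z *\<^sub>R g z \<partial>lborel)"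
    using g_b by (rule integral_completion)
  also have "\<dots> = (\<integral>z. g z \<partial>(unit_measure \<Otimes>\<^sub>M unit_measure))"
    unfolding unit_measure_pair using sq by (intro integral_restrict_space[symmetric]) auto
  finally show ?thesis .
qed

text \<open>
  Subsets of null sets are measurable for the completed measure, so equality almost everywhere transfers
  measurability from \<open>g\<close> to \<open>f\<close>.
\<close>

lemma integral_completion_AE:
  fixes f :: "'a \<Rightarrow> real"
  assumes g: "g \<in> borel_measurable N" and eq: "AE x in N. f x = g x"
  shows "(\<integral>x. f x \<partial>completion N) = (\<integral>x. g x \<partial>N)"
proof -
  have ae: "AE x in completion N. f x = g x" using eq by (simp add: AE_completion_iff)
  have g': "g \<in> borel_measurable (completion N)" using g by (rule measurable_completion)
  have "f \<in> borel_measurable (completion N)"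
  proof (rule measurableI)
    fix A :: "real set" assume A: "A \<in> sets borel"
    show "f -` A \<inter> space (completion N) \<in> sets (completion N)"
    proof (rule completion.in_sets_AE)
      show "g -` A \<inter> space (completion N) \<in> sets (completion N)" using g' A by (rule measurable_sets)
      show "AE x in completion N. (x \<in> g -` A \<inter> space (completion N)) = (x \<in> f -` A \<inter> space (completion N))"
        using ae by eventually_elim auto
    qed auto
  qed simp
  then have "(\<integral>x. f x \<partial>completion N) = (\<integral>x. g x \<partial>completion N)"
    using g' ae by (intro integral_cong_AE)
  then show ?thesis using integral_completion[OF g] by simp
qed

section \<open>The pentagon density near one half\<close>

lemma prod_C5_edges:
  fixes \<phi> :: "nat \<Rightarrow> nat \<Rightarrow> real"
  shows "(\<Prod>e\<in>C5_edges. \<phi> (Min e) (Max e)) = \<phi> 1 2 * \<phi> 2 3 * \<phi> 3 4 * \<phi> 4 5 * \<phi> 1 5"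
  by (simp add: C5_edges_def doubleton_eq_iff numeral_2_eq_2[symmetric])

lemma non_edges_C5: "non_edges 5 C5_edges = {{1,3}, {1,4}, {2,4}, {2,5}, {3,5}}"
proof (intro equalityI subsetI)
  fix e assume e: "e \<in> non_edges 5 C5_edges"
  then obtain x y where xy: "e = {x, y}" "x \<noteq> y" "x \<in> {1..5}" "y \<in> {1..5}"
    unfolding non_edges_def vertex_pairs_def card_2_iff by blast
  have "{1..5} = {1, 2, 3, 4, 5 :: nat}" by auto
  then have "x \<in> {1, 2, 3, 4, 5}" "y \<in> {1, 2, 3, 4, 5}" using xy(3,4) by simp_all
  moreover have "{x, y} \<notin> C5_edges" using e xy(1) by (simp add: non_edges_def)
  ultimately have "{x, y} \<in> {{1,3}, {1,4}, {2,4}, {2,5}, {3,5}}"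
    using xy(2) unfolding C5_edges_def by (elim insertE emptyE) (simp_all add: doubleton_eq_iff)
  then show "e \<in> {{1,3}, {1,4}, {2,4}, {2,5}, {3,5}}" using xy(1) by simp
next
  fix e :: "nat set" assume "e \<in> {{1,3}, {1,4}, {2,4}, {2,5}, {3,5}}"
  then show "e \<in> non_edges 5 C5_edges"
    by (elim insertE emptyE) (simp_all add: non_edges_def vertex_pairs_def C5_edges_def doubleton_eq_iff)
qed

lemma prod_C5_non_edges:
  fixes \<phi> :: "nat \<Rightarrow> nat \<Rightarrow> real"
  shows "(\<Prod>e\<in>non_edges 5 C5_edges. \<phi> (Min e) (Max e)) = \<phi> 1 3 * \<phi> 1 4 * \<phi> 2 4 * \<phi> 2 5 * \<phi> 3 5"
  by (simp add: non_edges_C5 doubleton_eq_iff)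

lemma rand_C5_half: "rand 5 C5_edges (1 / 2) = 1 / 1024"
proof -
  have "card C5_edges = 5" by (simp add: C5_edges_def doubleton_eq_iff)
  moreover have "(5::nat) choose 2 = 10" by (simp add: choose_two)
  ultimately show ?thesis by (simp add: rand_def power_one_over)
qed

text \<open>
  With \<open>u = x\<^sup>2 \<le> 1\<close>, all terms beyond the leading one are at most \<open>R\<close> times the next power of \<open>u\<close>. For
  \<open>u R \<le> m / 2\<close> they consume at most half of the leading term \<open>-m u\<close> or \<open>-m u\<^sup>2\<close>, and \<open>-u \<le> -u\<^sup>2\<close>.
\<close>

lemma even_polynomial_bound:
  fixes b :: "nat \<Rightarrow> real"
  assumes "b 2 \<le> 0" "b 2 = 0 \<Longrightarrow> b 4 < 0"
  shows "\<exists>c > 0. \<exists>\<delta> > 0. \<forall>x. \<bar>x\<bar> \<le> \<delta> \<longrightarrow>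
    x\<^sup>2 * b 2 + x ^ 4 * b 4 + x ^ 6 * b 6 + x ^ 8 * b 8 + x ^ 10 * b 10 \<le> - c * x ^ 4"
proof -
  define R where "R = \<bar>b 4\<bar> + \<bar>b 6\<bar> + \<bar>b 8\<bar> + \<bar>b 10\<bar> + 1"
  have R: "R > 0" by (simp add: R_def add_nonneg_pos)
  define m where "m = (if b 2 = 0 then - b 4 else - b 2)"
  have m: "m > 0" using assms by (auto simp: m_def)
  define \<delta> where "\<delta> = min 1 (m / (2 * R))"
  have \<delta>: "0 < \<delta>" "\<delta> \<le> 1" "\<delta> * R \<le> m / 2" using m R by (auto simp: \<delta>_def min_def field_simps)
  show ?thesis
  proof (rule exI[of _ "m / 2"], rule conjI, use m in simp, rule exI[of _ \<delta>], intro conjI allI impI)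
    fix x :: real assume x: "\<bar>x\<bar> \<le> \<delta>"
    define u where "u = x\<^sup>2"
    have u0: "0 \<le> u" by (simp add: u_def)
    have "\<bar>x\<bar> * \<bar>x\<bar> \<le> \<delta> * 1" using x \<delta> by (intro mult_mono) auto
    then have u\<delta>: "u \<le> \<delta>" by (simp add: u_def power2_eq_square abs_mult_self_eq)
    have "u * R \<le> \<delta> * R" using u\<delta> R by (intro mult_right_mono) auto
    with u\<delta> have u1: "u \<le> 1" and uR: "u * R \<le> m / 2" using \<delta> by linarith+
    have pow: "u ^ k * b j \<le> u ^ i * \<bar>b j\<bar>" if "i \<le> k" for i j k
    proof -
      have "u ^ k * b j \<le> u ^ k * \<bar>b j\<bar>" using u0 by (intro mult_left_mono) auto
      also have "\<dots> \<le> u ^ i * \<bar>b j\<bar>" using u0 u1 that by (intro mult_right_mono power_decreasing) auto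
      finally show ?thesis .
    qed
    have eq: "x\<^sup>2 * b 2 + x ^ 4 * b 4 + x ^ 6 * b 6 + x ^ 8 * b 8 + x ^ 10 * b 10
      = u * b 2 + u ^ 2 * b 4 + u ^ 3 * b 6 + u ^ 4 * b 8 + u ^ 5 * b 10"
      by (simp add: u_def flip: power_mult)
    have goal4: "x ^ 4 = u\<^sup>2" by (simp add: u_def flip: power_mult)
    have "u * b 2 + u ^ 2 * b 4 + u ^ 3 * b 6 + u ^ 4 * b 8 + u ^ 5 * b 10 \<le> - (m / 2) * u\<^sup>2"
    proof (cases "b 2 = 0")
      case True
      have "u ^ 3 * R = u ^ 3 * \<bar>b 4\<bar> + u ^ 3 * \<bar>b 6\<bar> + u ^ 3 * \<bar>b 8\<bar> + u ^ 3 * \<bar>b 10\<bar> + u ^ 3"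
        by (simp add: R_def algebra_simps)
      moreover have "0 \<le> u ^ 3 * \<bar>b 4\<bar>" "0 \<le> u ^ 3" using u0 by simp_all
      ultimately have "u ^ 3 * b 6 + u ^ 4 * b 8 + u ^ 5 * b 10 \<le> u ^ 3 * R"
        using pow[of 3 3 6] pow[of 3 4 8] pow[of 3 5 10] by linarith
      also have "\<dots> \<le> u\<^sup>2 * (m / 2)"
        using mult_left_mono[OF uR, of "u\<^sup>2"] by (simp add: power3_eq_cube power2_eq_square)
      finally show ?thesis using True by (simp add: m_def algebra_simps)
    next
      case False
      have "u ^ 2 * R = u ^ 2 * \<bar>b 4\<bar> + u ^ 2 * \<bar>b 6\<bar> + u ^ 2 * \<bar>b 8\<bar> + u ^ 2 * \<bar>b 10\<bar> + u ^ 2"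
        by (simp add: R_def algebra_simps)
      moreover have "0 \<le> u ^ 2" by simp
      ultimately have "u ^ 2 * b 4 + u ^ 3 * b 6 + u ^ 4 * b 8 + u ^ 5 * b 10 \<le> u ^ 2 * R"
        using pow[of 2 2 4] pow[of 2 3 6] pow[of 2 4 8] pow[of 2 5 10] by linarith
      also have "\<dots> \<le> u * (m / 2)"
        using mult_left_mono[OF uR u0] by (simp add: power2_eq_square algebra_simps)
      finally have "u * b 2 + u ^ 2 * b 4 + u ^ 3 * b 6 + u ^ 4 * b 8 + u ^ 5 * b 10 \<le> - (m / 2) * u"
        using False by (simp add: m_def algebra_simps)
      also have "\<dots> \<le> - (m / 2) * u\<^sup>2"
        using m u0 u1 mult_left_mono[of u 1 u] by (simp add: power2_eq_square mult_left_mono)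
      finally show ?thesis .
    qed
    then show "x\<^sup>2 * b 2 + x ^ 4 * b 4 + x ^ 6 * b 6 + x ^ 8 * b 8 + x ^ 10 * b 10 \<le> - (m / 2) * x ^ 4"
      using eq goal4 by simp
  qed (use \<delta> in auto)
qed

lemma (in kernel_on_5_points) signed_expectation_eq:
  "signed_expectation a = 1 + (a\<^sup>2 * coefficient 2 + a ^ 4 * coefficient 4 + a ^ 6 * coefficient 6
    + a ^ 8 * coefficient 8 + a ^ 10 * coefficient 10)"
proof -
  have sum10: "(\<Sum>k\<le>10. f k) = f 0 + f 1 + f 2 + f 3 + f 4 + f 5 + f 6 + f 7 + f 8 + f 9 + f 10"
    for f :: "nat \<Rightarrow> real" by (simp add: eval_nat_numeral)
  have "signed_expectation a + signed_expectation (- a) = 2 * (1 + (a\<^sup>2 * coefficient 2 + a ^ 4 * coefficient 4 + a ^ 6 * coefficient 6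
    + a ^ 8 * coefficient 8 + a ^ 10 * coefficient 10))"
    unfolding signed_expectation_expand sum10 by (simp add: coefficient_0)
  then show ?thesis by (simp add: signed_expectation_even)
qed

text \<open>
  Each of the ten factors \<open>1/2 \<plusminus> \<epsilon> \<Delta>\<close> is half of \<open>1 \<plusminus> 2 \<epsilon> \<Delta>\<close>. Two of the points are jointly uniform on the
  unit square, so \<open>\<Delta>\<close> and \<open>K\<close> agree almost surely at all ten pairs.
\<close>

lemma rho_C5_eq:
  assumes "bounded_symmetric_kernel unit_measure K B {1..5::nat}"
    and \<Delta>_eq: "AE z in unit_measure \<Otimes>\<^sub>M unit_measure. \<Delta> z = case_prod K z"
  shows "rho 5 C5_edges (\<lambda>z. const_kernel (1 / 2) z + \<epsilon> * \<Delta> z)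
    = kernel_on_5_points.signed_expectation unit_measure K {1..5} (2 * \<epsilon>) / 1024"
proof -
  interpret kernel_on_5_points unit_measure K B "{1..5}"
    using assms(1) by (simp add: kernel_on_5_points_def kernel_on_5_points_axioms_def)
  let ?W = "\<lambda>z. const_kernel (1 / 2) z + \<epsilon> * \<Delta> z"
  let ?g = "\<lambda>x. \<Prod>e\<leftarrow>K5_edges. 1 + 2 * \<epsilon> * (C5_sign e * K (x (fst e)) (x (snd e)))"
  have "AE x in P. \<forall>e\<in>set K5_edges. \<Delta> (x (fst e), x (snd e)) = K (x (fst e)) (x (snd e))"
  proof (rule AE_finite_allI)
    fix e assume "e \<in> set K5_edges"
    then have "fst e \<in> {1..5}" "snd e \<in> {1..5}" "fst e \<noteq> snd e" by (auto simp: K5_edges_def)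
    from AE_pair_coordinates[OF this \<Delta>_eq]
    show "AE x in P. \<Delta> (x (fst e), x (snd e)) = K (x (fst e)) (x (snd e))" by simp
  qed simp
  then have ae: "AE x in P. (\<Prod>e\<in>C5_edges. ?W (x (Min e), x (Max e))) *
      (\<Prod>f\<in>non_edges 5 C5_edges. 1 - ?W (x (Min f), x (Max f))) = ?g x / 1024"
  proof eventually_elim
    case (elim x)
    have halve: "1 - (1 / 2 + \<epsilon> * k) = (1 - 2 * \<epsilon> * k) / 2" "1 / 2 + \<epsilon> * k = (1 + 2 * \<epsilon> * k) / 2" for k
      by simp_all
    have \<Delta>_K: "\<Delta> (x i, x j) = K (x i) (x j)" if "(i, j) \<in> set K5_edges" for i j
      using bspec[OF elim that] by simp
    have edges: "(\<Prod>e\<in>C5_edges. ?W (x (Min e), x (Max e)))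
      = (1 + 2 * \<epsilon> * K (x 1) (x 2)) / 2 * ((1 + 2 * \<epsilon> * K (x 2) (x 3)) / 2) * ((1 + 2 * \<epsilon> * K (x 3) (x 4)) / 2)
        * ((1 + 2 * \<epsilon> * K (x 4) (x 5)) / 2) * ((1 + 2 * \<epsilon> * K (x 1) (x 5)) / 2)"
      unfolding prod_C5_edges[of "\<lambda>i j. ?W (x i, x j)"] unfolding const_kernel_def halve
      by (simp add: \<Delta>_K K5_edges_def)
    have non_edges: "(\<Prod>f\<in>non_edges 5 C5_edges. 1 - ?W (x (Min f), x (Max f)))
      = (1 - 2 * \<epsilon> * K (x 1) (x 3)) / 2 * ((1 - 2 * \<epsilon> * K (x 1) (x 4)) / 2) * ((1 - 2 * \<epsilon> * K (x 2) (x 4)) / 2)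
        * ((1 - 2 * \<epsilon> * K (x 2) (x 5)) / 2) * ((1 - 2 * \<epsilon> * K (x 3) (x 5)) / 2)"
      unfolding prod_C5_non_edges[of "\<lambda>i j. 1 - ?W (x i, x j)"] unfolding const_kernel_def halve(1)
      by (simp add: \<Delta>_K K5_edges_def)
    show ?case unfolding edges non_edges by (simp add: K5_edges_def C5_sign_def)
  qed
  have "rho 5 C5_edges ?W = (\<integral>x. ?g x / 1024 \<partial>P)"
    unfolding rho_def cube_measure_def
    by (rule integral_completion_AE[OF _ ae])
      (intro borel_measurable_divide borel_measurable_const measurable_signed_product; simp add: K5_edges_def)
  then show ?thesis unfolding signed_expectation_def by simp
qed

theorem proposition2p2:
  fixes \<Delta> :: "real \<times> real \<Rightarrow> real" and p :: real
  assumes "p = 1 / 2"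
    and "is_kernel \<Delta>"
    and "(\<integral>z. \<Delta> z \<partial>lebesgue_on unit_square) = 0"
    and "\<not> (AE z in lebesgue_on unit_square. \<Delta> z = 0)"
  shows "\<exists>c > 0. \<exists>\<epsilon>\<^sub>0 > 0. \<forall>\<epsilon>::real. \<bar>\<epsilon>\<bar> \<le> \<epsilon>\<^sub>0 \<longrightarrow>
    rho 5 C5_edges (\<lambda>z. const_kernel p z + \<epsilon> * \<Delta> z) \<le> rand 5 C5_edges p - c * \<epsilon> ^ 4"
proof -
  obtain K B where K: "bounded_symmetric_kernel unit_measure K B {1..5::nat}"
    and \<Delta>_eq: "AE z in unit_measure \<Otimes>\<^sub>M unit_measure. \<Delta> z = case_prod K z"
    using borel_version_of_kernel[OF assms(2)] by blast
  interpret kernel_on_5_points unit_measure K B "{1..5}"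
    using K by (simp add: kernel_on_5_points_def kernel_on_5_points_axioms_def)
  have "(\<integral>z. case_prod K z \<partial>(unit_measure \<Otimes>\<^sub>M unit_measure)) = 0"
    using integral_lebesgue_on_eq[OF K_measurable _ \<Delta>_eq] assms(2,3) by (simp add: is_kernel_def)
  then have mean: "(\<integral>y. kernel_degree y \<partial>unit_measure) = 0"
    by (simp add: integral_kernel_degree)
  have nonzero: "\<not> (AE z in unit_measure \<Otimes>\<^sub>M unit_measure. case_prod K z = 0)"
  proof
    assume "AE z in unit_measure \<Otimes>\<^sub>M unit_measure. case_prod K z = 0"
    with \<Delta>_eq have "AE z in unit_measure \<Otimes>\<^sub>M unit_measure. \<Delta> z = 0" by eventually_elim simp
    then show False using assms(4) AE_lebesgue_on_iff by blast
  qed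
  have "coefficient 2 \<le> 0"
    using coefficient_2[OF mean] degree_energy_nonneg by simp
  moreover have "coefficient 4 < 0" if "coefficient 2 = 0"
  proof -
    have "AE y in unit_measure. kernel_degree y = 0"
      using that coefficient_2[OF mean] by (intro degree_energy_eq_0_imp) simp
    moreover have "C4_density \<noteq> 0"
      using C4_density_eq_0_imp_AE_0[of 1 2 3] nonzero by auto
    ultimately show ?thesis
      using coefficient_4 C4_density_nonneg by simp
  qed
  ultimately obtain c \<delta> where "c > 0" "\<delta> > 0" and bound: "\<And>x. \<bar>x\<bar> \<le> \<delta> \<Longrightarrow>
    x\<^sup>2 * coefficient 2 + x ^ 4 * coefficient 4 + x ^ 6 * coefficient 6 + x ^ 8 * coefficient 8
      + x ^ 10 * coefficient 10 \<le> - c * x ^ 4"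
    using even_polynomial_bound[of coefficient] by metis
  (* The factor 64 is 1024 / 2 ^ 4, from x = 2 \<epsilon> and the normalisation of the density. *)
  show ?thesis
  proof (rule exI[of _ "c / 64"], rule conjI, use \<open>c > 0\<close> in simp, rule exI[of _ "\<delta> / 2"], intro conjI allI impI)
    fix \<epsilon> :: real assume "\<bar>\<epsilon>\<bar> \<le> \<delta> / 2"
    then have "\<bar>2 * \<epsilon>\<bar> \<le> \<delta>" by simp
    then have "signed_expectation (2 * \<epsilon>) \<le> 1 - c * (2 * \<epsilon>) ^ 4"
      using bound[of "2 * \<epsilon>"] signed_expectation_eq[of "2 * \<epsilon>"] by linarith
    then show "rho 5 C5_edges (\<lambda>z. const_kernel p z + \<epsilon> * \<Delta> z) \<le> rand 5 C5_edges p - c / 64 * \<epsilon> ^ 4"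
      unfolding assms(1) rand_C5_half rho_C5_eq[OF K \<Delta>_eq]
      by (simp add: power_mult_distrib field_simps)
  qed (use \<open>\<delta> > 0\<close> in simp)
qed

end
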